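(* Let $k,m\in\mathbb N$ and $\lambda:m\to k$ a function. For each $i\in k$ let $(S_i,+_i)$ be an adequate partial semigroup, $\mathbb P_i$ a finite ordered set, and $\alpha_i$ an action of $\mathbb P_i$ on $S_i$ (given by $t\mapsto S_{i,t}$ and $\mathcal F_{\alpha_i}$ with spines $f_\tau$), and let $\xi_i\in(\gamma S_i)_{\alpha_i}$ be an order-preserving idempotent. Set $S:=S_{\lambda(0)}\times\cdots\times S_{\lambda(m-1)}$, let $c$ be a finite coloring of $S$, extended canonically to $\beta S$. For each $i\in k$ fix functions $\psi^{(\mathcal F)}_{i,n}:(S_i^{\mathbb P_i})^n\to[\mathcal F_{\alpha_i}]^{<\aleph_0}$ and $\psi^{(S)}_{i,n}:(S_i^{\mathbb P_i})^n\to[S_i]^{<\aleph_0}$ ($n\in\omega$) such that $\psi^{(S)}_{i,n}(x_{i,0},\dots,x_{i,n-1})$ contains the range of $\tau_j\circ x_{i,j}$ for every $j<n$ and $\tau_j\in\psi^{(\mathcal F)}_{i,j}(x_{i,0},\dots,x_{i,j-1})$. Then there exist sequences $(x_{i,n})_{n\in\omega}$ of functions $x_{i,n}:\mathbb P_i\to S_i$ ($i\in k$) such that: (a) $x_{i,n}(t)\in S_{i,t}\cap\varphi_{S_i}(\psi^{(S)}_{i,n}(x_{i,0},\dots,x_{i,n-1}))$ for all $n\in\omega$, $i\in k$, $t\in\mathbb P_i$; (b) for all finite nonempty $F_0<F_1<\cdots<F_{m-1}$ in $\omega$, sequences $(t_{i,n})_{n}$ in $\mathbb P_i$ and $(\tau_{i,n})_n$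 in $\mathcal F_{\alpha_i}$ ($i\in k$) with $\tau_{i,n}\in\psi^{(\mathcal F)}_{i,n}(x_{i,0},\dots,x_{i,n-1})$, if for each $s\in m$ the set $\{f_{\tau_{\lambda(s),d}}(t_{\lambda(s),d}):d\in F_s\}$ is a chain in $\mathbb P_{\lambda(s)}$ with least element $t_s$, then the color of $$\Big(\sum\nolimits^{\lambda(s)}_{d\in F_s}\tau_{\lambda(s),d}\big(x_{\lambda(s),d}(t_{\lambda(s),d})\big)\Big)_{s\in m}$$ equals the color of $\xi_{\lambda(0)}(t_0)\otimes\xi_{\lambda(1)}(t_1)\otimes\cdots\otimes\xi_{\lambda(m-1)}(t_{m-1})$.
   Context: $\omega=\{0,1,\dots\}$, $n=\{0,\dots,n-1\}$; $[A]^{<\aleph_0}$ = finite subsets; for finite nonempty $A,B\subseteq\omega$, $A<B$ means $\max A<\min B$. Partial semigroups (partial associative operation), $\varphi_S(A)=\{x:a+x\text{ defined }\forall a\in A\}$, adequacy ($\varphi_S(A)\ne\emptyset$ for finite $A$), adequate homomorphisms (for each finite $B$ there is finite $A$ with $f(\varphi(A))\subseteq\varphi(B)$), adequate partial subsemigroups (subsets closed under $+$ with adequate inclusion), ordered by $S_0\le S_1$ iff $s_0+s_1,s_1+s_0\in S_0$ whenever defined; $\mathrm{End}(S)$ = adequate homomorphisms $S\to S$. $\gamma S$: ultrafilters $\mathcal U$ on $S$ containing $\{y:x+y\text{ defined}\}$ for every $x$, a compact right topological semigroup with $A\in\mathcal U+\mathcal V$ iff $\{x:\{y:x+y\in A\}\in\mathcal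 V\}\in\mathcal U$; idempotents ordered by $e\le e'$ iff $e+e'=e'+e=e$; $\tau\in\mathrm{End}(S)$ extends continuously to $\gamma S$ via $A\in\tau(\mathcal U)$ iff $\tau^{-1}(A)\in\mathcal U$; $\gamma S_t=\{\mathcal U\in\gamma S:S_t\in\mathcal U\}$. An action of $\mathbb P$ on $S$: order-preserving $t\mapsto S_t$ into adequate partial subsemigroups and a subsemigroup $\mathcal F_\alpha\subseteq\mathrm{End}(S)$, each $\tau$ with spine $f_\tau:\mathbb P\to\mathbb P$, $\tau(S_t)\subseteq S_{f_\tau(t)}$, $\tau(s)=s$ for $s\in S_t$ with $f_\tau(t)=t$. $(\gamma S)_\alpha$: maps $\xi$ with $\xi(t)\in\gamma S_t$ and $\tau\circ\xi=\xi\circ f_\tau$; order-preserving idempotent: each $\xi(t)$ idempotent and $\xi(t)\le\xi(t_0)$ when $t\le t_0$. Finite coloring $c$ of a set $D$ extends to ultrafilters by $c(\mathcal U)=i$ iff $\{x:c(x)=i\}\in\mathcal U$. Tensor product: for ultrafilters $\mathcal U$ on $A$, $\mathcal V$ on $B$, $C\in\mathcal U\otimes\mathcal V$ iff $\{a:\{b:(a,b)\in C\}\in\mathcal V\}\in\mathcal U$; iterated products are ultrafilters on the product set. $\sum^j_{d\in F}y_d$ denotes $y_{d_0}+_j\cdots+_jy_{d_\ell}$ for $F=\{d_0<\dots<d_\ell\}$, and writing it asserts it is defined. *)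

theory Defs
  imports Main "HOL-Library.FuncSet"
begin

section \<open>Partial semigroups\<close>

text \<open>\<open>padd S x y = Some z\<close> means that \<open>x + y\<close> is defined and equals \<open>z\<close>; the value of \<open>padd S\<close>
  is relevant on the carrier only.\<close>

record 'a psg =
  car :: "'a set"
  padd :: "'a \<Rightarrow> 'a \<Rightarrow> 'a option"

text \<open>Associativity of a partial operation: if one of \<open>(x + y) + z\<close> and \<open>x + (y + z)\<close> is defined,
  so is the other, and they are equal.\<close>

definition partial_semigroup :: "'a psg \<Rightarrow> bool" where
  "partial_semigroup S \<longleftrightarrow>
     (\<forall>x\<in>car S. \<forall>y\<in>car S. \<forall>z. padd S x y = Some z \<longrightarrow> z \<in> car S) \<and>
     (\<forall>x\<in>car S. \<forall>y\<in>car S. \<forall>z\<in>car S.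
        Option.bind (padd S x y) (\<lambda>u. padd S u z) = Option.bind (padd S y z) (\<lambda>v. padd S x v))"

definition phi :: "'a psg \<Rightarrow> 'a set \<Rightarrow> 'a set" where
  "phi S A = {x \<in> car S. \<forall>a\<in>A. padd S a x \<noteq> None}"

definition adequate :: "'a psg \<Rightarrow> bool" where
  "adequate S \<longleftrightarrow>
     partial_semigroup S \<and> (\<forall>A. finite A \<and> A \<subseteq> car S \<longrightarrow> phi S A \<noteq> {})"

definition adequate_hom :: "'a psg \<Rightarrow> 'b psg \<Rightarrow> ('a \<Rightarrow> 'b) \<Rightarrow> bool" where
  "adequate_hom S T f \<longleftrightarrow>
     f \<in> car S \<rightarrow> car T \<and>
     (\<forall>x\<in>car S. \<forall>y\<in>car S. \<forall>z. padd S x y = Some z \<longrightarrow> padd T (f x) (f y) = Some (f z)) \<and>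
     (\<forall>B. finite B \<and> B \<subseteq> car T \<longrightarrow>
        (\<exists>A. finite A \<and> A \<subseteq> car S \<and> f ` phi S A \<subseteq> phi T B))"

definition adequate_subsemigroup :: "'a set \<Rightarrow> 'a psg \<Rightarrow> bool" where
  "adequate_subsemigroup T S \<longleftrightarrow>
     T \<subseteq> car S \<and>
     (\<forall>x\<in>T. \<forall>y\<in>T. \<forall>z. padd S x y = Some z \<longrightarrow> z \<in> T) \<and>
     adequate (S\<lparr>car := T\<rparr>) \<and>
     adequate_hom (S\<lparr>car := T\<rparr>) S (\<lambda>x. x)"

definition subsemigroup_le :: "'a psg \<Rightarrow> 'a set \<Rightarrow> 'a set \<Rightarrow> bool" where
  "subsemigroup_le S T0 T1 \<longleftrightarrow>
     (\<forall>x\<in>T0. \<forall>y\<in>T1. \<forall>z. padd S x y = Some z \<or> padd S y x = Some z \<longrightarrow> z \<in> T0)"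

text \<open>Endomorphisms are extensional, so that maps agreeing on the carrier are equal as elements of
  the endomorphism set.\<close>

definition End :: "'a psg \<Rightarrow> ('a \<Rightarrow> 'a) set" where
  "End S = {\<tau> \<in> car S \<rightarrow>\<^sub>E car S. adequate_hom S S \<tau>}"

fun psum_list :: "'a psg \<Rightarrow> 'a list \<Rightarrow> 'a option" where
  "psum_list S [] = None"
| "psum_list S [x] = Some x"
| "psum_list S (x # y # ys) = Option.bind (padd S x y) (\<lambda>z. psum_list S (z # ys))"

definition psum :: "'a psg \<Rightarrow> (nat \<Rightarrow> 'a) \<Rightarrow> nat set \<Rightarrow> 'a option" where
  "psum S y F = psum_list S (map y (sorted_list_of_set F))"


section \<open>Ultrafilters\<close>

definition ultrafilter_on :: "'a set \<Rightarrow> 'a set set \<Rightarrow> bool" where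
  "ultrafilter_on D U \<longleftrightarrow>
     U \<subseteq> Pow D \<and> D \<in> U \<and> {} \<notin> U \<and>
     (\<forall>X\<in>U. \<forall>Y\<in>U. X \<inter> Y \<in> U) \<and>
     (\<forall>X\<in>U. \<forall>Y. X \<subseteq> Y \<and> Y \<subseteq> D \<longrightarrow> Y \<in> U) \<and>
     (\<forall>X\<subseteq>D. X \<in> U \<or> D - X \<in> U)"

definition gamma :: "'a psg \<Rightarrow> 'a set set set" where
  "gamma S = {U. ultrafilter_on (car S) U \<and>
                 (\<forall>x\<in>car S. {y \<in> car S. padd S x y \<noteq> None} \<in> U)}"

definition gamma_sub :: "'a psg \<Rightarrow> 'a set \<Rightarrow> 'a set set set" where
  "gamma_sub S T = {U \<in> gamma S. T \<in> U}"

definition uadd :: "'a psg \<Rightarrow> 'a set set \<Rightarrow> 'a set set \<Rightarrow> 'a set set" where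
  "uadd S U V =
     {A. A \<subseteq> car S \<and> {x \<in> car S. {y \<in> car S. \<exists>z\<in>A. padd S x y = Some z} \<in> V} \<in> U}"

definition uidem :: "'a psg \<Rightarrow> 'a set set \<Rightarrow> bool" where
  "uidem S e \<longleftrightarrow> uadd S e e = e"

definition uidem_le :: "'a psg \<Rightarrow> 'a set set \<Rightarrow> 'a set set \<Rightarrow> bool" where
  "uidem_le S e e' \<longleftrightarrow> uadd S e e' = e \<and> uadd S e' e = e"

definition upush :: "'a psg \<Rightarrow> ('a \<Rightarrow> 'a) \<Rightarrow> 'a set set \<Rightarrow> 'a set set" where
  "upush S \<tau> U = {A. A \<subseteq> car S \<and> {x \<in> car S. \<tau> x \<in> A} \<in> U}"

definition utensor :: "'a set \<Rightarrow> 'b set \<Rightarrow> 'a set set \<Rightarrow> 'b set set \<Rightarrow> ('a \<times> 'b) set set" where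
  "utensor A B U V = {C. C \<subseteq> A \<times> B \<and> {a \<in> A. {b \<in> B. (a, b) \<in> C} \<in> V} \<in> U}"

text \<open>The product \<open>D 0 \<times> \<dots> \<times> D (m-1)\<close> is the set \<open>PiE {..<m} D\<close>, and
  \<open>utensor_iter D W m\<close> is \<open>W 0 \<otimes> \<dots> \<otimes> W (m-1)\<close> on it, bracketed to the left and transported along
  the bijection \<open>(x, y) \<mapsto> x(n := y)\<close> from \<open>PiE {..<n} D \<times> D n\<close> to \<open>PiE {..<Suc n} D\<close>. The empty
  product is the unique ultrafilter on a one-point set.\<close>

primrec utensor_iter ::
    "(nat \<Rightarrow> 'a set) \<Rightarrow> (nat \<Rightarrow> 'a set set) \<Rightarrow> nat \<Rightarrow> (nat \<Rightarrow> 'a) set set" where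
  "utensor_iter D W 0 = {PiE {..<0} D}"
| "utensor_iter D W (Suc n) =
     {C. C \<subseteq> PiE {..<Suc n} D \<and>
         {(x, y). x \<in> PiE {..<n} D \<and> y \<in> D n \<and> x(n := y) \<in> C}
           \<in> utensor (PiE {..<n} D) (D n) (utensor_iter D W n) (W n)}"

text \<open>The color of an ultrafilter \<open>U\<close> on \<open>D\<close>: the \<open>i\<close> with \<open>c -` {i} \<inter> D \<in> U\<close>, unique by the next lemma when \<open>c\<close> takes finitely many values on \<open>D\<close>.\<close>

definition color_ext :: "'b set \<Rightarrow> ('b \<Rightarrow> 'c) \<Rightarrow> 'b set set \<Rightarrow> 'c" where
  "color_ext D c U = (THE i. {x \<in> D. c x = i} \<in> U)"

lemma color_ext_iff:
  assumes U: "ultrafilter_on D U" and fin: "finite (c ` D)"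
  shows "color_ext D c U = i \<longleftrightarrow> {x \<in> D. c x = i} \<in> U"
proof -
  have inter: "X \<inter> Y \<in> U" if "X \<in> U" "Y \<in> U" for X Y
    using U that by (simp add: ultrafilter_on_def)
  have compl: "D - X \<in> U" if "X \<subseteq> D" "X \<notin> U" for X
    using U that by (simp add: ultrafilter_on_def) metis
  have up: "Y \<in> U" if "X \<in> U" "X \<subseteq> Y" "Y \<subseteq> D" for X Y
    using U that by (simp add: ultrafilter_on_def)
  have ne: "{} \<notin> U" and D: "D \<in> U"
    using U by (simp_all add: ultrafilter_on_def)
  have un: "i = j" if "{x \<in> D. c x = i} \<in> U" "{x \<in> D. c x = j} \<in> U" for i j
  proof (rule ccontr)
    assume "i \<noteq> j"
    then have "{x \<in> D. c x = i} \<inter> {x \<in> D. c x = j} = {}" by auto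
    with inter[OF that] ne show False by simp
  qed
  have *: "\<exists>i\<in>I. {x \<in> D. c x = i} \<in> U" if "finite I" "{x \<in> D. c x \<in> I} \<in> U" for I
    using that
  proof (induction I rule: finite_induct)
    case empty
    then show ?case using ne by simp
  next
    case (insert a I)
    show ?case
    proof (cases "{x \<in> D. c x = a} \<in> U")
      case False
      then have "D - {x \<in> D. c x = a} \<in> U" by (intro compl) auto
      from inter[OF insert.prems this] have "{x \<in> D. c x \<in> I} \<in> U"
        by (rule up) auto
      then show ?thesis using insert.IH by auto
    qed simp
  qed
  have "{x \<in> D. c x \<in> c ` D} = D" by auto
  with D have "{x \<in> D. c x \<in> c ` D} \<in> U" by simp
  from *[OF fin this] obtain j where j: "{x \<in> D. c x = j} \<in> U" by auto
  have "color_ext D c U = j"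
    unfolding color_ext_def by (rule the_equality) (use j un in metis)+
  then show ?thesis using j un by metis
qed


section \<open>Actions of finite ordered sets\<close>

text \<open>An ordered set is a carrier \<open>P\<close> with a relation \<open>r\<close> such that \<^prop>\<open>partial_order_on P r\<close>;
  \<open>(s, t) \<in> r\<close> means \<open>s \<le> t\<close>. An action consists of the sets \<open>S\<^sub>t\<close> (\<open>act_sub\<close>), the set of
  endomorphisms (\<open>act_maps\<close>) and a chosen spine for each of these.\<close>

record ('a, 'p) psg_action =
  act_sub :: "'p \<Rightarrow> 'a set"
  act_maps :: "('a \<Rightarrow> 'a) set"
  spine :: "('a \<Rightarrow> 'a) \<Rightarrow> 'p \<Rightarrow> 'p"

definition is_action :: "'a psg \<Rightarrow> 'p set \<Rightarrow> 'p rel \<Rightarrow> ('a, 'p) psg_action \<Rightarrow> bool" where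
  "is_action S P r \<alpha> \<longleftrightarrow>
     (\<forall>t\<in>P. adequate_subsemigroup (act_sub \<alpha> t) S) \<and>
     (\<forall>s\<in>P. \<forall>t\<in>P. (s, t) \<in> r \<longrightarrow> subsemigroup_le S (act_sub \<alpha> s) (act_sub \<alpha> t)) \<and>
     act_maps \<alpha> \<subseteq> End S \<and>
     (\<forall>\<sigma>\<in>act_maps \<alpha>. \<forall>\<tau>\<in>act_maps \<alpha>. compose (car S) \<sigma> \<tau> \<in> act_maps \<alpha>) \<and>
     (\<forall>\<tau>\<in>act_maps \<alpha>.
        spine \<alpha> \<tau> \<in> P \<rightarrow> P \<and>
        (\<forall>t\<in>P. \<tau> ` act_sub \<alpha> t \<subseteq> act_sub \<alpha> (spine \<alpha> \<tau> t)) \<and>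
        (\<forall>t\<in>P. spine \<alpha> \<tau> t = t \<longrightarrow> (\<forall>s\<in>act_sub \<alpha> t. \<tau> s = s)))"

definition gamma_action ::
    "'a psg \<Rightarrow> 'p set \<Rightarrow> ('a, 'p) psg_action \<Rightarrow> ('p \<Rightarrow> 'a set set) set" where
  "gamma_action S P \<alpha> =
     {\<xi>. (\<forall>t\<in>P. \<xi> t \<in> gamma_sub S (act_sub \<alpha> t)) \<and>
         (\<forall>\<tau>\<in>act_maps \<alpha>. \<forall>t\<in>P. upush S \<tau> (\<xi> t) = \<xi> (spine \<alpha> \<tau> t))}"

definition order_preserving_idempotent ::
    "'a psg \<Rightarrow> 'p set \<Rightarrow> 'p rel \<Rightarrow> ('p \<Rightarrow> 'a set set) \<Rightarrow> bool" where
  "order_preserving_idempotent S P r \<xi> \<longleftrightarrow>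
     (\<forall>t\<in>P. uidem S (\<xi> t)) \<and>
     (\<forall>t\<in>P. \<forall>t0\<in>P. (t, t0) \<in> r \<longrightarrow> uidem_le S (\<xi> t) (\<xi> t0))"

definition least_of :: "'p rel \<Rightarrow> 'p set \<Rightarrow> 'p \<Rightarrow> bool" where
  "least_of r C t \<longleftrightarrow> t \<in> C \<and> (\<forall>u\<in>C. (t, u) \<in> r)"

definition block_less :: "nat set \<Rightarrow> nat set \<Rightarrow> bool" where
  "block_less A B \<longleftrightarrow> Max A < Min B"

text \<open>A family \<open>\<psi>\<^sub>n\<close> (\<open>n \<in> \<omega>\<close>) of functions of \<open>n\<close> arguments is encoded as one function on lists,
  \<open>\<psi>\<^sub>n\<close> being its restriction to lists of length \<open>n\<close>; the arguments are the elements of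
  \<open>P \<rightarrow>\<^sub>E car S\<close>, the maps from \<open>P\<close> to \<open>S\<close>.\<close>

definition admissible_psi ::
    "'a psg \<Rightarrow> 'p set \<Rightarrow> ('a, 'p) psg_action \<Rightarrow>
     (('p \<Rightarrow> 'a) list \<Rightarrow> ('a \<Rightarrow> 'a) set) \<Rightarrow> (('p \<Rightarrow> 'a) list \<Rightarrow> 'a set) \<Rightarrow> bool" where
  "admissible_psi S P \<alpha> \<psi>F \<psi>S \<longleftrightarrow>
     (\<forall>xs \<in> lists (P \<rightarrow>\<^sub>E car S).
        finite (\<psi>F xs) \<and> \<psi>F xs \<subseteq> act_maps \<alpha> \<and>
        finite (\<psi>S xs) \<and> \<psi>S xs \<subseteq> car S \<and>
        (\<forall>j<length xs. \<forall>\<tau>\<in>\<psi>F (take j xs). (\<lambda>t. \<tau> ((xs ! j) t)) ` P \<subseteq> \<psi>S xs))"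

end

theory Submission
  imports Defs
begin

text \<open>The sequences are built recursively. A state describes how far a block configuration has been
  read: which blocks are complete, their sums, and the partial sum of the current block. A state is
  good if all its continuations have the right color for almost all choices of the remaining
  summands, first with respect to the idempotents that can still enter the current block, then with
  respect to the iterated tensor product over the later blocks. Since the idempotents absorb each
  other along chains and \<open>\<tau> \<circ> \<xi> = \<xi> \<circ> f\<^sub>\<tau>\<close>, a good state remains good after reading
  \<open>\<tau> (x t)\<close> for \<open>\<xi> t\<close>-almost all values of \<open>x t\<close>. At each stage only finitely many states can be
  reached, so the next \<open>x\<close> can be chosen to keep all of them good.\<close>

section \<open>Ultrafilters as quantifiers "for almost all"\<close>

lemma ultrafilter_onD:
  assumes "ultrafilter_on D U"
  shows "\<And>X. X \<in> U \<Longrightarrow> X \<subseteq> D" "D \<in> U" "{} \<notin> U"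
    "\<And>X Y. X \<in> U \<Longrightarrow> Y \<in> U \<Longrightarrow> X \<inter> Y \<in> U"
    "\<And>X Y. X \<in> U \<Longrightarrow> X \<subseteq> Y \<Longrightarrow> Y \<subseteq> D \<Longrightarrow> Y \<in> U"
    "\<And>X. X \<subseteq> D \<Longrightarrow> X \<notin> U \<Longrightarrow> D - X \<in> U"
proof -
  note U = assms[unfolded ultrafilter_on_def]
  show "X \<subseteq> D" if "X \<in> U" for X using U that by blast
  show "D \<in> U" "{} \<notin> U" using U by simp_all
  show "X \<inter> Y \<in> U" if "X \<in> U" "Y \<in> U" for X Y using U that by simp
  show "Y \<in> U" if "X \<in> U" "X \<subseteq> Y" "Y \<subseteq> D" for X Y using U that by simp
  show "D - X \<in> U" if "X \<subseteq> D" "X \<notin> U" for X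
    using U that by (elim conjE allE[of _ X] impE) simp_all
qed

lemma ultrafilter_on_mono:
  assumes "ultrafilter_on D U" "{x \<in> D. Q x} \<in> U" "\<And>x. x \<in> D \<Longrightarrow> Q x \<Longrightarrow> R x"
  shows "{x \<in> D. R x} \<in> U"
  by (rule ultrafilter_onD(5)[OF assms(1,2)]) (use assms(3) in auto)

lemma ultrafilter_on_conj:
  assumes "ultrafilter_on D U" "{x \<in> D. Q x} \<in> U" "{x \<in> D. R x} \<in> U"
  shows "{x \<in> D. Q x \<and> R x} \<in> U"
proof -
  have "{x \<in> D. Q x} \<inter> {x \<in> D. R x} = {x \<in> D. Q x \<and> R x}" by auto
  then show ?thesis using ultrafilter_onD(4)[OF assms] by simp
qed

lemma ultrafilter_on_ball:
  assumes "ultrafilter_on D U" "finite I" "\<And>i. i \<in> I \<Longrightarrow> {x \<in> D. Q i x} \<in> U"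
  shows "{x \<in> D. \<forall>i\<in>I. Q i x} \<in> U"
  using assms(2,3)
proof (induction I rule: finite_induct)
  case empty
  then show ?case using ultrafilter_onD(2)[OF assms(1)] by simp
next
  case (insert i I)
  have "{x \<in> D. Q i x \<and> (\<forall>i\<in>I. Q i x)} \<in> U"
    by (rule ultrafilter_on_conj[OF assms(1)]) (use insert in auto)
  then show ?case by simp
qed

section \<open>Iterated tensor products\<close>

text \<open>The section at \<open>y\<close> of the set of pairs in the definition is
  \<open>{a \<in> D n. y(n := a) \<in> C}\<close>. Membership thus becomes a nested quantifier:
  almost all \<open>y\<close>, then almost all last coordinates \<open>a\<close>.\<close>

lemma utensor_iter_Suc_iff:
  "C \<in> utensor_iter D W (Suc n) \<longleftrightarrow>
     C \<subseteq> PiE {..<Suc n} D \<and>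
     {y \<in> PiE {..<n} D. {a \<in> D n. y(n := a) \<in> C} \<in> W n} \<in> utensor_iter D W n"
proof -
  have "{b \<in> D n. (y, b) \<in> {(x, y). x \<in> PiE {..<n} D \<and> y \<in> D n \<and> x(n := y) \<in> C}}
      = {b \<in> D n. y(n := b) \<in> C}" if "y \<in> PiE {..<n} D" for y
    using that by auto
  then have "{y \<in> PiE {..<n} D.
        {b \<in> D n. (y, b) \<in> {(x, y). x \<in> PiE {..<n} D \<and> y \<in> D n \<and> x(n := y) \<in> C}} \<in> W n}
      = {y \<in> PiE {..<n} D. {b \<in> D n. y(n := b) \<in> C} \<in> W n}"
    by (metis (no_types, lifting))
  then show ?thesis
    unfolding utensor_iter.simps utensor_def by auto
qed

lemma PiE_lessThan_Suc_upd:
  "y \<in> PiE {..<n} D \<Longrightarrow> a \<in> D n \<Longrightarrow> y(n := a) \<in> PiE {..<Suc n} D"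
  unfolding lessThan_Suc by (rule PiE_fun_upd)

text \<open>Taking sections commutes with intersections and complements, so each axiom is inherited
  from the two factors. This is what allows \<open>color_ext_iff\<close> to be applied to the tensor
  product.\<close>

lemma ultrafilter_on_utensor_iter:
  assumes "\<And>s. s < n \<Longrightarrow> ultrafilter_on (D s) (W s)"
  shows "ultrafilter_on (PiE {..<n} D) (utensor_iter D W n)"
  using assms
proof (induction n)
  case 0
  then show ?case by (auto simp: ultrafilter_on_def)
next
  case (Suc n)
  let ?U = "utensor_iter D W n"
  let ?sec = "\<lambda>C y. {a \<in> D n. y(n := a) \<in> C}"
  have U: "ultrafilter_on (PiE {..<n} D) ?U" and W: "ultrafilter_on (D n) (W n)"
    using Suc by auto
  have D: "?sec (PiE {..<Suc n} D) y = D n" if "y \<in> PiE {..<n} D" for y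
    using PiE_lessThan_Suc_upd[OF that] by blast
  show ?case
    unfolding ultrafilter_on_def
  proof (intro conjI ballI allI impI)
    show "utensor_iter D W (Suc n) \<subseteq> Pow (PiE {..<Suc n} D)"
      by (auto simp: utensor_iter_Suc_iff)
    have "{y \<in> PiE {..<n} D. ?sec (PiE {..<Suc n} D) y \<in> W n} = PiE {..<n} D"
      using D ultrafilter_onD(2)[OF W] by auto
    then show "PiE {..<Suc n} D \<in> utensor_iter D W (Suc n)"
      using ultrafilter_onD(2)[OF U] unfolding utensor_iter_Suc_iff by simp
    show "{} \<notin> utensor_iter D W (Suc n)"
      using ultrafilter_onD(3)[OF U] ultrafilter_onD(3)[OF W]
      unfolding utensor_iter_Suc_iff by simp
    show "X \<inter> Y \<in> utensor_iter D W (Suc n)"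
      if "X \<in> utensor_iter D W (Suc n)" "Y \<in> utensor_iter D W (Suc n)" for X Y
    proof -
      have "{y \<in> PiE {..<n} D. ?sec X y \<in> W n \<and> ?sec Y y \<in> W n} \<in> ?U"
        using that unfolding utensor_iter_Suc_iff by (intro ultrafilter_on_conj[OF U]) blast+
      then have "{y \<in> PiE {..<n} D. ?sec (X \<inter> Y) y \<in> W n} \<in> ?U"
      proof (rule ultrafilter_on_mono[OF U])
        fix y assume "?sec X y \<in> W n \<and> ?sec Y y \<in> W n"
        then have "{a \<in> D n. y(n := a) \<in> X \<and> y(n := a) \<in> Y} \<in> W n"
          by (intro ultrafilter_on_conj[OF W]) blast+
        then show "?sec (X \<inter> Y) y \<in> W n" by simp
      qed
      with that show ?thesis unfolding utensor_iter_Suc_iff by auto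
    qed
    show "Y \<in> utensor_iter D W (Suc n)"
      if "X \<in> utensor_iter D W (Suc n)" "X \<subseteq> Y \<and> Y \<subseteq> PiE {..<Suc n} D" for X Y
    proof -
      have "{y \<in> PiE {..<n} D. ?sec X y \<in> W n} \<in> ?U"
        using that unfolding utensor_iter_Suc_iff by auto
      then have "{y \<in> PiE {..<n} D. ?sec Y y \<in> W n} \<in> ?U"
      proof (rule ultrafilter_on_mono[OF U])
        show "?sec Y y \<in> W n" if "?sec X y \<in> W n" for y
          using that by (rule ultrafilter_on_mono[OF W]) (use \<open>X \<subseteq> Y \<and> _\<close> in blast)
      qed
      with that show ?thesis unfolding utensor_iter_Suc_iff by auto
    qed
    show "X \<in> utensor_iter D W (Suc n) \<or> PiE {..<Suc n} D - X \<in> utensor_iter D W (Suc n)"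
      if X: "X \<subseteq> PiE {..<Suc n} D" for X
    proof (rule disjCI)
      assume "PiE {..<Suc n} D - X \<notin> utensor_iter D W (Suc n)"
      then have "{y \<in> PiE {..<n} D. ?sec (PiE {..<Suc n} D - X) y \<in> W n} \<notin> ?U"
        unfolding utensor_iter_Suc_iff by auto
      then have "PiE {..<n} D - {y \<in> PiE {..<n} D. ?sec (PiE {..<Suc n} D - X) y \<in> W n} \<in> ?U"
        by (intro ultrafilter_onD(6)[OF U]) auto
      \<comment> \<open>Where the section of the complement is not large, the section of
        \<open>X\<close> is, since the two sections partition \<open>D n\<close>.\<close>
      moreover have "PiE {..<n} D - {y \<in> PiE {..<n} D. ?sec (PiE {..<Suc n} D - X) y \<in> W n}
          \<subseteq> {y \<in> PiE {..<n} D. ?sec X y \<in> W n}"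
      proof clarsimp
        fix y assume y: "y \<in> PiE {..<n} D"
          and *: "{a \<in> D n. y(n := a) \<in> PiE {..<Suc n} D \<and> y(n := a) \<notin> X} \<notin> W n"
        show "?sec X y \<in> W n"
        proof (rule ccontr)
          assume "?sec X y \<notin> W n"
          then have "D n - ?sec X y \<in> W n"
            by (intro ultrafilter_onD(6)[OF W]) auto
          moreover have "D n - ?sec X y
              = {a \<in> D n. y(n := a) \<in> PiE {..<Suc n} D \<and> y(n := a) \<notin> X}"
            using D[OF y] by auto
          ultimately show False using * by simp
        qed
      qed
      ultimately have "{y \<in> PiE {..<n} D. ?sec X y \<in> W n} \<in> ?U"
        by (rule ultrafilter_onD(5)[OF U]) auto
      with X show "X \<in> utensor_iter D W (Suc n)" unfolding utensor_iter_Suc_iff by auto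
    qed
  qed
qed

lemma utensor_iter_cong:
  "(\<And>s. s < n \<Longrightarrow> W s = W' s) \<Longrightarrow> utensor_iter D W n = utensor_iter D W' n"
  by (induction n) auto

text \<open>A large set is unfolded into a tree of admissible initial segments. Coordinates can then
  be chosen one after another from left to right, each with regard to a single ultrafilter
  \<open>W s\<close>.\<close>

lemma utensor_iter_sections:
  assumes "A \<in> utensor_iter D W n"
  shows "\<exists>G. G n = A \<and> (\<lambda>_. undefined) \<in> G 0 \<and>
    (\<forall>s<n. \<forall>y\<in>G s. {a \<in> D s. y(s := a) \<in> G (Suc s)} \<in> W s)"
  using assms
proof (induction n arbitrary: A)
  case 0
  \<comment> \<open>The empty product is \<open>{\<lambda>_. undefined}\<close>, and this is the
    only possible \<open>A\<close>.\<close>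
  then show ?case by (intro exI[of _ "\<lambda>_. A"]) auto
next
  case (Suc n)
  from Suc.IH[OF conjunct2[OF Suc.prems[unfolded utensor_iter_Suc_iff]]]
  obtain G where G: "G n = {y \<in> PiE {..<n} D. {a \<in> D n. y(n := a) \<in> A} \<in> W n}"
      "(\<lambda>_. undefined) \<in> G 0"
      "\<forall>s<n. \<forall>y\<in>G s. {a \<in> D s. y(s := a) \<in> G (Suc s)} \<in> W s"
    by blast
  \<comment> \<open>The tree from the induction hypothesis ends in the set of \<open>y\<close> whose
    section of \<open>A\<close> is large, so \<open>A\<close> itself can be put on top of
    it.\<close>
  let ?G = "\<lambda>s. if s = Suc n then A else G s"
  have sec: "{a \<in> D s. y(s := a) \<in> ?G (Suc s)} \<in> W s" if s: "s < Suc n" and y: "y \<in> ?G s" for s y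
  proof (cases "s = n")
    case True
    with y G(1) show ?thesis by simp
  next
    case False
    with s y G(3) show ?thesis by simp
  qed
  moreover have "?G (Suc n) = A" "(\<lambda>_. undefined) \<in> ?G 0" using G(2) by simp_all
  moreover have "\<forall>s<Suc n. \<forall>y\<in>?G s. {a \<in> D s. y(s := a) \<in> ?G (Suc s)} \<in> W s"
    using sec by blast
  ultimately show ?case by (intro exI[of _ ?G] conjI)
qed

section \<open>Sums along lists and increasing enumerations\<close>

text \<open>\<open>psum_list\<close> accumulates from the left, so a last summand is added without
  appeal to associativity.\<close>

lemma psum_list_append1:
  "zs \<noteq> [] \<Longrightarrow> psum_list S (zs @ [a]) = Option.bind (psum_list S zs) (\<lambda>z. padd S z a)"
proof (induction S zs rule: psum_list.induct)
  case (3 S x y ys)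
  then show ?case by (cases "padd S x y") auto
qed auto

lemma sorted_list_of_set_inter_Suc:
  fixes F :: "nat set"
  assumes "n \<in> F"
  shows "sorted_list_of_set (F \<inter> {..<Suc n}) = sorted_list_of_set (F \<inter> {..<n}) @ [n]"
proof -
  have "set (sorted_list_of_set (F \<inter> {..<Suc n})) = F \<inter> {..<Suc n}"
    by (rule set_sorted_list_of_set) simp
  also have "\<dots> = set (sorted_list_of_set (F \<inter> {..<n}) @ [n])"
    using assms by (auto simp: less_Suc_eq)
  finally show ?thesis
    by (rule sorted_distinct_set_unique[rotated 4]) (simp_all add: sorted_append)
qed

section \<open>Chains of idempotents that absorb one another\<close>

definition chain_least :: "'p set \<Rightarrow> 'p rel \<Rightarrow> 'p set \<Rightarrow> 'p \<Rightarrow> bool" where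
  "chain_least P r C u \<longleftrightarrow> C \<subseteq> P \<and> C \<in> Chains r \<and> least_of r C u"

locale ordered_idempotents =
  fixes S :: "'a psg" and P :: "'p set" and r :: "'p rel" and \<xi> :: "'p \<Rightarrow> 'a set set"
  assumes psg: "partial_semigroup S"
    and finP: "finite P"
    and po: "partial_order_on P r"
    and gam: "\<And>t. t \<in> P \<Longrightarrow> \<xi> t \<in> gamma S"
    and opi: "order_preserving_idempotent S P r \<xi>"
begin

lemma uf: "t \<in> P \<Longrightarrow> ultrafilter_on (car S) (\<xi> t)"
  using gam by (auto simp: gamma_def)

text \<open>Both \<open>p\<close> and \<open>e\<close> lie in a chain, hence are comparable, and
  \<open>d\<close> is the smaller of them. Order preservation makes the smaller idempotent absorb
  the larger one from either side.\<close>

lemma uadd_chain_least: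
  assumes p: "p \<in> P" and E: "chain_least P r E e" and d: "chain_least P r (insert p E) d"
  shows "uadd S (\<xi> p) (\<xi> e) = \<xi> d"
proof -
  have tr: "trans r" and an: "antisym r"
    using po by (auto simp: partial_order_on_def preorder_on_def)
  have e: "e \<in> E" "e \<in> P" "\<And>u. u \<in> E \<Longrightarrow> (e, u) \<in> r"
    using E by (auto simp: chain_least_def least_of_def)
  have d': "d = p \<or> d \<in> E" "(d, p) \<in> r" "(d, e) \<in> r"
    using d e by (auto simp: chain_least_def least_of_def)
  have "(p, e) \<in> r \<or> (e, p) \<in> r"
    using d e(1) unfolding chain_least_def Chains_def by blast
  then show ?thesis
  proof
    assume pe: "(p, e) \<in> r"
    then have "d = p" using d' e(3) tr an by (meson antisymD transD)
    with pe p e(2) opi show ?thesis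
      by (auto simp: order_preserving_idempotent_def uidem_le_def)
  next
    assume ep: "(e, p) \<in> r"
    then have "d = e" using d' e(3) tr an by (meson antisymD transD)
    with ep p e(2) opi show ?thesis
      by (auto simp: order_preserving_idempotent_def uidem_le_def)
  qed
qed

text \<open>The invariant of a partial sum \<open>z\<close> whose summands were taken at the points of \<open>C\<close>: every
  continuation whose total set of points is a chain with least element \<open>u\<close> ends up in \<open>B\<close>.
  Quantifying over chains \<open>E\<close> of further points, rather than over single points, is what makes the
  invariant self-reproducing, because points comparable with \<open>u\<close> need not be comparable with each
  other.\<close>

definition good :: "'a set \<Rightarrow> 'p \<Rightarrow> 'p set \<Rightarrow> 'a \<Rightarrow> bool" where
  "good B u C z \<longleftrightarrow> z \<in> car S \<and> (chain_least P r C u \<longrightarrow> z \<in> B) \<and>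
     (\<forall>E\<in>Pow P. \<forall>e\<in>P. chain_least P r E e \<longrightarrow> chain_least P r (C \<union> E) u \<longrightarrow>
        {w \<in> car S. \<exists>v\<in>B. padd S z w = Some v} \<in> \<xi> e)"

text \<open>The case of a first summand. A continuation along \<open>E\<close> with least element
  \<open>e\<close> is governed by \<open>\<xi> p + \<xi> e = \<xi> u\<close>, which contains
  \<open>B\<close>. As \<open>P\<close> is finite, the conditions for all \<open>E\<close> and
  \<open>e\<close> can be imposed at once.\<close>

lemma good_start:
  assumes p: "p \<in> P" and B: "B \<in> \<xi> u" and u: "u \<in> P"
  shows "{z \<in> car S. good B u {p} z} \<in> \<xi> p"
proof -
  have "{z \<in> car S. chain_least P r {p} u \<longrightarrow> z \<in> B} \<in> \<xi> p"
  proof (cases "chain_least P r {p} u")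
    case True
    then have "u = p" by (auto simp: chain_least_def least_of_def)
    then have "{z \<in> car S. z \<in> B} = B" using ultrafilter_onD(1)[OF uf[OF u] B] by auto
    with True B \<open>u = p\<close> show ?thesis by simp
  next
    case False
    then show ?thesis using ultrafilter_onD(2)[OF uf[OF p]] by simp
  qed
  moreover have "{z \<in> car S. \<forall>E\<in>Pow P. \<forall>e\<in>P. chain_least P r E e \<longrightarrow>
      chain_least P r ({p} \<union> E) u \<longrightarrow> {w \<in> car S. \<exists>v\<in>B. padd S z w = Some v} \<in> \<xi> e} \<in> \<xi> p"
  proof (intro ultrafilter_on_ball[OF uf[OF p]] finP finite_Pow_iff[THEN iffD2])
    fix E e assume "E \<in> Pow P" "e \<in> P"
    show "{z \<in> car S. chain_least P r E e \<longrightarrow> chain_least P r ({p} \<union> E) u \<longrightarrow>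
        {w \<in> car S. \<exists>v\<in>B. padd S z w = Some v} \<in> \<xi> e} \<in> \<xi> p"
    proof (cases "chain_least P r E e \<and> chain_least P r ({p} \<union> E) u")
      case True
      then have "B \<in> uadd S (\<xi> p) (\<xi> e)"
        using uadd_chain_least[OF p, of E e u] B by simp
      with True show ?thesis by (simp add: uadd_def)
    next
      case False
      then have "{z \<in> car S. chain_least P r E e \<longrightarrow> chain_least P r ({p} \<union> E) u \<longrightarrow>
        {w \<in> car S. \<exists>v\<in>B. padd S z w = Some v} \<in> \<xi> e} = car S" by auto
      then show ?thesis using ultrafilter_onD(2)[OF uf[OF p]] by simp
    qed
  qed
  ultimately have "{z \<in> car S. (chain_least P r {p} u \<longrightarrow> z \<in> B) \<and> (\<forall>E\<in>Pow P. \<forall>e\<in>P.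
      chain_least P r E e \<longrightarrow> chain_least P r ({p} \<union> E) u \<longrightarrow>
      {w \<in> car S. \<exists>v\<in>B. padd S z w = Some v} \<in> \<xi> e)} \<in> \<xi> p"
    by (rule ultrafilter_on_conj[OF uf[OF p]])
  then show ?thesis
    by (rule ultrafilter_on_mono[OF uf[OF p]]) (simp add: good_def)
qed

text \<open>A continuation \<open>E\<close> of \<open>z + w\<close> is treated as the continuation
  \<open>insert p E\<close> of \<open>z\<close>. Associativity and \<open>uadd_chain_least\<close>
  then turn the invariant of \<open>z\<close> into that of \<open>z + w\<close>.\<close>

lemma good_step:
  assumes p: "p \<in> P" and g: "good B u C z"
  shows "{w \<in> car S. \<exists>v. padd S z w = Some v \<and> good B u (insert p C) v} \<in> \<xi> p"
proof -
  note U = uf[OF p]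
  have z: "z \<in> car S" using g by (simp add: good_def)
  let ?B = "{w \<in> car S. \<exists>v\<in>B. padd S z w = Some v}"
  have gE: "?B \<in> \<xi> e" if "chain_least P r E e" "chain_least P r (C \<union> E) u" for E e
  proof -
    have "E \<in> Pow P" "e \<in> P" using that by (auto simp: chain_least_def least_of_def)
    then show ?thesis using g that unfolding good_def by blast
  qed
  have 1: "{w \<in> car S. padd S z w \<noteq> None} \<in> \<xi> p"
    using gam[OF p] z by (simp add: gamma_def)
  have 2: "{w \<in> car S. chain_least P r (insert p C) u \<longrightarrow> w \<in> ?B} \<in> \<xi> p"
  proof (cases "chain_least P r (insert p C) u")
    case True
    \<comment> \<open>Stopping right after \<open>w\<close> is the continuation of \<open>z\<close>
      by the one-point chain \<open>{p}\<close>.\<close>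
    have "chain_least P r {p} p"
      using True p by (auto simp: chain_least_def least_of_def Chains_def)
    with gE[of "{p}" p] True show ?thesis by simp
  next
    case False
    then show ?thesis using ultrafilter_onD(2)[OF U] by simp
  qed
  \<comment> \<open>The requirement on \<open>(z + w) + w'\<close> is expressed through
    \<open>w + w'\<close>, which has to lie in \<open>?B\<close>.\<close>
  have 3: "{w \<in> car S. \<forall>E\<in>Pow P. \<forall>e\<in>P. chain_least P r E e \<longrightarrow>
      chain_least P r (insert p C \<union> E) u \<longrightarrow>
      {w' \<in> car S. \<exists>v\<in>?B. padd S w w' = Some v} \<in> \<xi> e} \<in> \<xi> p"
  proof (intro ultrafilter_on_ball[OF U] finP finite_Pow_iff[THEN iffD2])
    fix E e assume "E \<in> Pow P" "e \<in> P"
    show "{w \<in> car S. chain_least P r E e \<longrightarrow> chain_least P r (insert p C \<union> E) u \<longrightarrow>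
        {w' \<in> car S. \<exists>v\<in>?B. padd S w w' = Some v} \<in> \<xi> e} \<in> \<xi> p"
    proof (cases "chain_least P r E e \<and> chain_least P r (insert p C \<union> E) u")
      case True
      have E: "chain_least P r E e" and CE: "chain_least P r (C \<union> insert p E) u"
        using True by auto
      have e: "e \<in> E" "\<And>v. v \<in> E \<Longrightarrow> (e, v) \<in> r"
        using E by (auto simp: chain_least_def least_of_def)
      have ch: "(v, w) \<in> r \<or> (w, v) \<in> r" if "v \<in> insert p E" "w \<in> insert p E" for v w
        using CE that unfolding chain_least_def Chains_def by blast
      have tr: "trans r" using po by (auto simp: partial_order_on_def preorder_on_def)
      \<comment> \<open>\<open>insert p E\<close> is part of a chain, so its least element is the
        smaller of \<open>p\<close> and \<open>e\<close>.\<close>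
      obtain d where d: "chain_least P r (insert p E) d"
      proof (cases "(p, e) \<in> r")
        case True
        then have "(p, v) \<in> r" if "v \<in> insert p E" for v
          using that e(2)[of v] ch[of p p] transD[OF tr, of p e v] by auto
        then have "chain_least P r (insert p E) p"
          using CE ch by (auto simp: chain_least_def least_of_def Chains_def)
        then show ?thesis by (rule that)
      next
        case False
        then have "(e, p) \<in> r" using ch e(1) by blast
        then have "chain_least P r (insert p E) e"
          using CE ch e by (auto simp: chain_least_def least_of_def Chains_def)
        then show ?thesis by (rule that)
      qed
      have "?B \<in> uadd S (\<xi> p) (\<xi> e)"
        using uadd_chain_least[OF p E d] gE[OF d CE] by simp
      then have "{w \<in> car S. {w' \<in> car S. \<exists>v\<in>?B. padd S w w' = Some v} \<in> \<xi> e} \<in> \<xi> p"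
        unfolding uadd_def by blast
      then show ?thesis by (rule ultrafilter_on_mono[OF U]) blast
    next
      case False
      then have "{w \<in> car S. chain_least P r E e \<longrightarrow> chain_least P r (insert p C \<union> E) u \<longrightarrow>
        {w' \<in> car S. \<exists>v\<in>?B. padd S w w' = Some v} \<in> \<xi> e} = car S" by auto
      then show ?thesis using ultrafilter_onD(2)[OF U] by simp
    qed
  qed
  show ?thesis
  proof (rule ultrafilter_on_mono[OF U ultrafilter_on_conj[OF U 1 ultrafilter_on_conj[OF U 2 3]]])
    fix w assume w: "w \<in> car S"
      and *: "padd S z w \<noteq> None \<and> (chain_least P r (insert p C) u \<longrightarrow> w \<in> ?B) \<and>
        (\<forall>E\<in>Pow P. \<forall>e\<in>P. chain_least P r E e \<longrightarrow> chain_least P r (insert p C \<union> E) u \<longrightarrow>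
          {w' \<in> car S. \<exists>v\<in>?B. padd S w w' = Some v} \<in> \<xi> e)"
    then obtain v where v: "padd S z w = Some v" by auto
    have vc: "v \<in> car S" using psg z w v unfolding partial_semigroup_def by blast
    have assoc: "padd S v w' = Option.bind (padd S w w') (padd S z)" if "w' \<in> car S" for w'
    proof -
      have "Option.bind (padd S z w) (\<lambda>u. padd S u w')
          = Option.bind (padd S w w') (\<lambda>v. padd S z v)"
        using psg z w that unfolding partial_semigroup_def by blast
      then show ?thesis using v by simp
    qed
    have "good B u (insert p C) v"
      unfolding good_def
    proof (intro conjI ballI impI vc)
      show "v \<in> B" if "chain_least P r (insert p C) u"
        using * that v by auto
      fix E e assume "E \<in> Pow P" and e: "e \<in> P" and "chain_least P r E e"
        "chain_least P r (insert p C \<union> E) u"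
      with * have "{w' \<in> car S. \<exists>v\<in>?B. padd S w w' = Some v} \<in> \<xi> e" by blast
      then show "{w \<in> car S. \<exists>b\<in>B. padd S v w = Some b} \<in> \<xi> e"
        by (rule ultrafilter_on_mono[OF uf[OF e]]) (auto simp: assoc)
    qed
    with v show "\<exists>v. padd S z w = Some v \<and> good B u (insert p C) v" by blast
  qed
qed

text \<open>A partial semigroup need not have a neutral element to serve as the empty sum. The start
  of a block is therefore a separate case, in which no point has been used.\<close>

definition good_list :: "'a set \<Rightarrow> 'p \<Rightarrow> 'p set \<Rightarrow> 'a list \<Rightarrow> bool" where
  "good_list B u C zs \<longleftrightarrow>
     (if zs = [] then C = {} else \<exists>z. psum_list S zs = Some z \<and> good B u C z)"

text \<open>Gives one uniform step for a block: \<open>good_start\<close> handles the first summand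
  and \<open>good_step\<close> the later ones.\<close>

lemma good_list_step:
  assumes p: "p \<in> P" and B: "B \<in> \<xi> u" and u: "u \<in> P" and g: "good_list B u C zs"
  shows "{a \<in> car S. good_list B u (insert p C) (zs @ [a])} \<in> \<xi> p"
proof (cases "zs = []")
  case True
  with g have "C = {}" by (simp add: good_list_def)
  from good_start[OF p B u] show ?thesis
    by (rule ultrafilter_on_mono[OF uf[OF p]]) (simp add: good_list_def True \<open>C = {}\<close>)
next
  case False
  with g obtain z where z: "psum_list S zs = Some z" "good B u C z"
    by (auto simp: good_list_def)
  from good_step[OF p z(2)] show ?thesis
    by (rule ultrafilter_on_mono[OF uf[OF p]])
      (use False z(1) in \<open>auto simp: good_list_def psum_list_append1\<close>)
qed

lemma good_listD:
  assumes "good_list B u C zs" "zs \<noteq> []" "chain_least P r C u"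
  shows "\<exists>z\<in>B. psum_list S zs = Some z"
  using assms by (auto simp: good_list_def good_def)

end

text \<open>A state \<open>(t, s, y, C, zs)\<close> records a guess \<open>t\<close> for the least elements of all blocks, the number
  \<open>s\<close> of completed blocks and their sums \<open>y\<close>, and for the block in progress the set \<open>C\<close> of points
  used and the list \<open>zs\<close> of summands.\<close>

type_synonym ('a, 'p) state = "(nat \<Rightarrow> 'p) \<times> nat \<times> (nat \<Rightarrow> 'a) \<times> 'p set \<times> 'a list"

section \<open>States of a partially read block configuration\<close>

text \<open>\<open>G t\<close> abstracts the tree of admissible tuples of block sums for a guess
  \<open>t\<close> of the least elements. The coloring enters the construction only through this
  tree.\<close>

locale action_family =
  fixes k m :: nat
    and lam :: "nat \<Rightarrow> nat"
    and S :: "nat \<Rightarrow> 'a psg"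
    and P :: "nat \<Rightarrow> 'p set"
    and r :: "nat \<Rightarrow> 'p rel"
    and \<alpha> :: "nat \<Rightarrow> ('a, 'p) psg_action"
    and \<xi> :: "nat \<Rightarrow> 'p \<Rightarrow> 'a set set"
    and \<psi>F :: "nat \<Rightarrow> ('p \<Rightarrow> 'a) list \<Rightarrow> ('a \<Rightarrow> 'a) set"
    and \<psi>S :: "nat \<Rightarrow> ('p \<Rightarrow> 'a) list \<Rightarrow> 'a set"
    and G :: "(nat \<Rightarrow> 'p) \<Rightarrow> nat \<Rightarrow> (nat \<Rightarrow> 'a) set"
  assumes lam: "lam \<in> {..<m} \<rightarrow> {..<k}"
    and adq: "\<And>i. i < k \<Longrightarrow> adequate (S i)"
    and fin: "\<And>i. i < k \<Longrightarrow> finite (P i)"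
    and po: "\<And>i. i < k \<Longrightarrow> partial_order_on (P i) (r i)"
    and act: "\<And>i. i < k \<Longrightarrow> is_action (S i) (P i) (r i) (\<alpha> i)"
    and gamma_act: "\<And>i. i < k \<Longrightarrow> \<xi> i \<in> gamma_action (S i) (P i) (\<alpha> i)"
    and opi: "\<And>i. i < k \<Longrightarrow> order_preserving_idempotent (S i) (P i) (r i) (\<xi> i)"
    and psi: "\<And>i. i < k \<Longrightarrow> admissible_psi (S i) (P i) (\<alpha> i) (\<psi>F i) (\<psi>S i)"
    and G_init: "\<And>t. t \<in> PiE {..<m} (\<lambda>s. P (lam s)) \<Longrightarrow> (\<lambda>_. undefined) \<in> G t 0"
    and G_step: "\<And>t s y. t \<in> PiE {..<m} (\<lambda>s. P (lam s)) \<Longrightarrow> s < m \<Longrightarrow> y \<in> G t s \<Longrightarrow>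
      {a \<in> car (S (lam s)). y(s := a) \<in> G t (Suc s)} \<in> \<xi> (lam s) (t s)"
begin

lemma ordered_idempotents: "i < k \<Longrightarrow> ordered_idempotents (S i) (P i) (r i) (\<xi> i)"
  using adq fin po gamma_act opi
  by (auto simp: ordered_idempotents_def adequate_def gamma_action_def gamma_sub_def)

lemma lam_less: "s < m \<Longrightarrow> lam s < k"
  using lam by auto

text \<open>The set handed to \<open>good_list\<close> consists of the sums that block
  \<open>s\<close> may take. Once \<open>s = m\<close> no block remains, and no unfinished data are
  allowed.\<close>

fun good_state :: "('a, 'p) state \<Rightarrow> bool" where
  "good_state (t, s, y, C, zs) \<longleftrightarrow>
     t \<in> PiE {..<m} (\<lambda>s. P (lam s)) \<and> s \<le> m \<and> y \<in> G t s \<and>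
     (if s < m
      then ordered_idempotents.good_list (S (lam s)) (P (lam s)) (r (lam s)) (\<xi> (lam s))
        {a \<in> car (S (lam s)). y(s := a) \<in> G t (Suc s)} (t s) C zs
      else C = {} \<and> zs = [])"

text \<open>The list \<open>h\<close> of earlier choices fixes which maps are available; the new
  choice \<open>v\<close> is read at every point with every such map. The guess \<open>t\<close> is
  not tested here.\<close>

fun moves :: "(nat \<Rightarrow> 'p \<Rightarrow> 'a) list \<Rightarrow> (nat \<Rightarrow> 'p \<Rightarrow> 'a) \<Rightarrow> ('a, 'p) state \<Rightarrow> ('a, 'p) state set" where
  "moves h v (t, s, y, C, zs) =
     (if s < m
      then (\<lambda>(p, \<tau>). (t, s, y, insert (spine (\<alpha> (lam s)) \<tau> p) C, zs @ [\<tau> (v (lam s) p)])) `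
        (P (lam s) \<times> \<psi>F (lam s) (map (\<lambda>w. w (lam s)) h))
      else {})"

text \<open>The guess is tested here: a block can be closed only if the points used form a chain
  whose least element is the guessed \<open>t s\<close>.\<close>

fun closings :: "('a, 'p) state \<Rightarrow> ('a, 'p) state set" where
  "closings (t, s, y, C, zs) =
     (if s < m \<and> zs \<noteq> [] \<and> chain_least (P (lam s)) (r (lam s)) C (t s)
      then {(t, Suc s, y(s := the (psum_list (S (lam s)) zs)), {}, [])}
      else {})"

lemma good_state_closed:
  assumes "t \<in> PiE {..<m} (\<lambda>s. P (lam s))" "s \<le> m" "y \<in> G t s"
  shows "good_state (t, s, y, {}, [])"
  using assms ordered_idempotents[OF lam_less[of s]]
  by (simp add: ordered_idempotents.good_list_def)

lemma good_state_psum: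
  assumes "good_state (t, s, y, C, zs)" "s < m" "zs \<noteq> []"
    "chain_least (P (lam s)) (r (lam s)) C (t s)"
  shows "\<exists>a. psum_list (S (lam s)) zs = Some a \<and> y(s := a) \<in> G t (Suc s)"
  using ordered_idempotents.good_listD[OF ordered_idempotents[OF lam_less], OF assms(2) _ assms(3,4)]
    assms(1,2) by fastforce

lemma good_state_closings:
  assumes "good_state \<sigma>" "\<sigma>' \<in> closings \<sigma>"
  shows "good_state \<sigma>'"
proof -
  obtain t s y C zs where \<sigma>: "\<sigma> = (t, s, y, C, zs)" by (metis prod_cases5)
  have s: "s < m" "zs \<noteq> []" "chain_least (P (lam s)) (r (lam s)) C (t s)"
    and \<sigma>': "\<sigma>' = (t, Suc s, y(s := the (psum_list (S (lam s)) zs)), {}, [])"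
    using assms(2) by (simp_all add: \<sigma> split: if_splits)
  from good_state_psum[OF assms(1)[unfolded \<sigma>] s]
  have "y(s := the (psum_list (S (lam s)) zs)) \<in> G t (Suc s)" by auto
  with assms(1) s show ?thesis
    unfolding \<sigma>' by (intro good_state_closed) (auto simp: \<sigma>)
qed

text \<open>Since \<open>\<tau>\<close> pushes \<open>\<xi> (lam s) p\<close> forward to the value
  of \<open>\<xi> (lam s)\<close> at the spine of \<open>p\<close>, \<open>good_list_step\<close> at
  that point pulls back along \<open>\<tau>\<close>.\<close>

lemma good_state_move:
  assumes g: "good_state (t, s, y, C, zs)" and s: "s < m" and p: "p \<in> P (lam s)"
    and \<tau>: "\<tau> \<in> act_maps (\<alpha> (lam s))"
  shows "{a \<in> car (S (lam s)).
    good_state (t, s, y, insert (spine (\<alpha> (lam s)) \<tau> p) C, zs @ [\<tau> a])} \<in> \<xi> (lam s) p"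
proof -
  note i = lam_less[OF s]
  interpret ordered_idempotents "S (lam s)" "P (lam s)" "r (lam s)" "\<xi> (lam s)"
    by (rule ordered_idempotents[OF i])
  let ?q = "spine (\<alpha> (lam s)) \<tau> p"
  let ?B = "{a \<in> car (S (lam s)). y(s := a) \<in> G t (Suc s)}"
  have t: "t \<in> PiE {..<m} (\<lambda>s. P (lam s))" and y: "y \<in> G t s" and gl: "good_list ?B (t s) C zs"
    using g s by auto
  have q: "?q \<in> P (lam s)" using act[OF i] \<tau> p unfolding is_action_def by blast
  have ts: "t s \<in> P (lam s)" using t s by auto
  from good_list_step[OF q G_step[OF t s y] ts gl]
  have "{b \<in> car (S (lam s)). good_list ?B (t s) (insert ?q C) (zs @ [b])}
      \<in> upush (S (lam s)) \<tau> (\<xi> (lam s) p)"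
    using gamma_act[OF i] \<tau> p by (simp add: gamma_action_def)
  then have "{x \<in> car (S (lam s)).
      \<tau> x \<in> {b \<in> car (S (lam s)). good_list ?B (t s) (insert ?q C) (zs @ [b])}} \<in> \<xi> (lam s) p"
    by (simp add: upush_def)
  then show ?thesis
    by (rule ultrafilter_on_mono[OF uf[OF p]]) (use s t y in auto)
qed

section \<open>Recursive choice of the sequences\<close>

text \<open>Finitely many states, maps and elements of \<open>\<psi>S\<close> put only finitely many
  large sets on each \<open>\<xi> i p\<close>, so these sets have a common element. A move reads a
  single value \<open>v (lam s) p\<close>; hence the values for different \<open>i\<close> and
  \<open>p\<close> can be chosen independently.\<close>

lemma one_step:
  assumes R: "finite R" "\<And>\<sigma>. \<sigma> \<in> R \<Longrightarrow> good_state \<sigma>"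
    and h: "\<And>w i. w \<in> set h \<Longrightarrow> i < k \<Longrightarrow> w i \<in> P i \<rightarrow>\<^sub>E car (S i)"
  shows "\<exists>v. (\<forall>i<k. v i \<in> P i \<rightarrow>\<^sub>E car (S i)) \<and>
    (\<forall>i<k. \<forall>p\<in>P i. v i p \<in> act_sub (\<alpha> i) p \<inter> phi (S i) (\<psi>S i (map (\<lambda>w. w i) h))) \<and>
    (\<forall>\<sigma>\<in>R. \<forall>\<sigma>'\<in>moves h v \<sigma>. good_state \<sigma>')"
proof -
  let ?h = "\<lambda>i. map (\<lambda>w. w i) h"
  \<comment> \<open>The condition is vacuous for completed states and for states whose current block
    is summed in a semigroup with another index.\<close>
  define ok where "ok i p a \<sigma> \<longleftrightarrow> (case \<sigma> of (t, s, y, C, zs) \<Rightarrow> s < m \<longrightarrow> lam s = i \<longrightarrow>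
      (\<forall>\<tau>\<in>\<psi>F i (?h i). good_state (t, s, y, insert (spine (\<alpha> i) \<tau> p) C, zs @ [\<tau> a])))" for i p a \<sigma>
  have "\<exists>a\<in>car (S i). a \<in> act_sub (\<alpha> i) p \<inter> phi (S i) (\<psi>S i (?h i)) \<and> (\<forall>\<sigma>\<in>R. ok i p a \<sigma>)"
    if i: "i < k" and p: "p \<in> P i" for i p
  proof -
    have U: "ultrafilter_on (car (S i)) (\<xi> i p)"
      by (rule ordered_idempotents.uf[OF ordered_idempotents[OF i] p])
    have \<xi>: "\<xi> i p \<in> gamma (S i)" "act_sub (\<alpha> i) p \<in> \<xi> i p"
      using gamma_act[OF i] p by (auto simp: gamma_action_def gamma_sub_def)
    have "?h i \<in> lists (P i \<rightarrow>\<^sub>E car (S i))"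
      using h[OF _ i] by (simp add: lists_eq_set image_subset_iff)
    with psi[OF i] have \<psi>: "finite (\<psi>F i (?h i))" "\<psi>F i (?h i) \<subseteq> act_maps (\<alpha> i)"
        "finite (\<psi>S i (?h i))" "\<psi>S i (?h i) \<subseteq> car (S i)"
      unfolding admissible_psi_def by blast+
    have 1: "{a \<in> car (S i). a \<in> act_sub (\<alpha> i) p} \<in> \<xi> i p"
    proof -
      have "{a \<in> car (S i). a \<in> act_sub (\<alpha> i) p} = act_sub (\<alpha> i) p"
        using ultrafilter_onD(1)[OF U \<xi>(2)] by auto
      with \<xi>(2) show ?thesis by simp
    qed
    have 2: "{a \<in> car (S i). \<forall>b\<in>\<psi>S i (?h i). padd (S i) b a \<noteq> None} \<in> \<xi> i p"
      by (rule ultrafilter_on_ball[OF U \<psi>(3)]) (use \<xi>(1) \<psi>(4) in \<open>auto simp: gamma_def\<close>)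
    have 3: "{a \<in> car (S i). \<forall>\<sigma>\<in>R. ok i p a \<sigma>} \<in> \<xi> i p"
    proof (rule ultrafilter_on_ball[OF U R(1)])
      fix \<sigma> assume "\<sigma> \<in> R"
      then have g: "good_state \<sigma>" by (rule R(2))
      obtain t s y C zs where \<sigma>: "\<sigma> = (t, s, y, C, zs)" by (metis prod_cases5)
      show "{a \<in> car (S i). ok i p a \<sigma>} \<in> \<xi> i p"
      proof (cases "s < m \<and> lam s = i")
        case True
        have "{a \<in> car (S i). \<forall>\<tau>\<in>\<psi>F i (?h i).
            good_state (t, s, y, insert (spine (\<alpha> i) \<tau> p) C, zs @ [\<tau> a])} \<in> \<xi> i p"
          using good_state_move[OF g[unfolded \<sigma>], of p] True p \<psi>(2)
          by (intro ultrafilter_on_ball[OF U \<psi>(1)]) (auto simp del: good_state.simps)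
        then show ?thesis
          by (rule ultrafilter_on_mono[OF U]) (simp add: ok_def \<sigma> del: good_state.simps)
      next
        case False
        then have "{a \<in> car (S i). ok i p a \<sigma>} = car (S i)"
          by (auto simp: ok_def \<sigma> simp del: good_state.simps)
        then show ?thesis using ultrafilter_onD(2)[OF U] by simp
      qed
    qed
    have "{a \<in> car (S i). a \<in> act_sub (\<alpha> i) p \<and>
        (\<forall>b\<in>\<psi>S i (?h i). padd (S i) b a \<noteq> None) \<and> (\<forall>\<sigma>\<in>R. ok i p a \<sigma>)} \<noteq> {}"
      using ultrafilter_on_conj[OF U 1 ultrafilter_on_conj[OF U 2 3]] ultrafilter_onD(3)[OF U]
      by metis
    then show ?thesis unfolding phi_def by blast
  qed
  then obtain v0 where v0: "\<And>i p. i < k \<Longrightarrow> p \<in> P i \<Longrightarrow> v0 i p \<in> car (S i) \<and>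
      v0 i p \<in> act_sub (\<alpha> i) p \<inter> phi (S i) (\<psi>S i (?h i)) \<and> (\<forall>\<sigma>\<in>R. ok i p (v0 i p) \<sigma>)"
    by metis
  let ?v = "\<lambda>i. restrict (v0 i) (P i)"
  show ?thesis
  proof (intro exI[of _ ?v] conjI allI impI ballI)
    fix \<sigma> \<sigma>' assume \<sigma>R: "\<sigma> \<in> R" and m: "\<sigma>' \<in> moves h ?v \<sigma>"
    obtain t s y C zs where \<sigma>: "\<sigma> = (t, s, y, C, zs)" by (metis prod_cases5)
    from m obtain p \<tau> where s: "s < m" and p: "p \<in> P (lam s)" "\<tau> \<in> \<psi>F (lam s) (?h (lam s))"
      and \<sigma>': "\<sigma>' = (t, s, y, insert (spine (\<alpha> (lam s)) \<tau> p) C, zs @ [\<tau> (v0 (lam s) p)])"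
      by (auto simp: \<sigma> split: if_splits)
    from v0[OF lam_less[OF s] p(1)] \<sigma>R have "ok (lam s) p (v0 (lam s) p) \<sigma>" by blast
    then show "good_state \<sigma>'"
      using s p(2) by (simp add: ok_def \<sigma> \<sigma>' del: good_state.simps)
  qed (use v0 in auto)
qed

text \<open>One round suffices: a freshly closed state has an empty list of summands and cannot be
  closed again.\<close>

definition close :: "('a, 'p) state set \<Rightarrow> ('a, 'p) state set" where
  "close R = R \<union> (\<Union>\<sigma>\<in>R. closings \<sigma>)"

lemma finite_moves:
  assumes "\<And>w i. w \<in> set h \<Longrightarrow> i < k \<Longrightarrow> w i \<in> P i \<rightarrow>\<^sub>E car (S i)"
  shows "finite (moves h v \<sigma>)"
proof -
  obtain t s y C zs where \<sigma>: "\<sigma> = (t, s, y, C, zs)" by (metis prod_cases5)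
  show ?thesis
  proof (cases "s < m")
    case True
    note i = lam_less[OF True]
    have "map (\<lambda>w. w (lam s)) h \<in> lists (P (lam s) \<rightarrow>\<^sub>E car (S (lam s)))"
      using assms[OF _ i] by (simp add: lists_eq_set image_subset_iff)
    with psi[OF i] have "finite (\<psi>F (lam s) (map (\<lambda>w. w (lam s)) h))"
      unfolding admissible_psi_def by blast
    with fin[OF i] show ?thesis by (simp add: \<sigma>)
  qed (simp add: \<sigma>)
qed

lemma finite_close: "finite R \<Longrightarrow> finite (close R)"
  by (auto simp: close_def)

text \<open>\<open>R n\<close> collects the states reachable by reading the choices below
  \<open>n\<close>. Old states are retained at each stage, which accounts for numbers that lie in no
  block.\<close>

lemma good_sequence:
  "\<exists>X R. R 0 = (\<lambda>t. (t, 0, (\<lambda>_. undefined), {}, [])) ` PiE {..<m} (\<lambda>s. P (lam s)) \<and>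
    (\<forall>n. R (Suc n) = close (R n \<union> (\<Union>\<sigma>\<in>R n. moves (map X [0..<n]) (X n) \<sigma>))) \<and>
    (\<forall>n. \<forall>\<sigma>\<in>R n. good_state \<sigma>) \<and>
    (\<forall>n. \<forall>i<k. X n i \<in> P i \<rightarrow>\<^sub>E car (S i)) \<and>
    (\<forall>n. \<forall>i<k. \<forall>p\<in>P i.
       X n i p \<in> act_sub (\<alpha> i) p \<inter> phi (S i) (\<psi>S i (map (\<lambda>w. w i) (map X [0..<n]))))"
proof -
  define ok where "ok h v \<longleftrightarrow> (\<forall>i<k. v i \<in> P i \<rightarrow>\<^sub>E car (S i)) \<and>
    (\<forall>i<k. \<forall>p\<in>P i. v i p \<in> act_sub (\<alpha> i) p \<inter> phi (S i) (\<psi>S i (map (\<lambda>w. w i) h)))" for h v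
  define R0 :: "('a, 'p) state set"
    where "R0 = (\<lambda>t. (t, 0, (\<lambda>_. undefined), {}, [])) ` PiE {..<m} (\<lambda>s. P (lam s))"
  define nxt where "nxt R h v = close (R \<union> (\<Union>\<sigma>\<in>R. moves h v \<sigma>))" for R h v
  define Inv where "Inv h R \<longleftrightarrow> finite R \<and> (\<forall>\<sigma>\<in>R. good_state \<sigma>) \<and>
    (\<forall>w\<in>set h. \<forall>i<k. w i \<in> P i \<rightarrow>\<^sub>E car (S i))" for h R
  have Inv0: "Inv [] R0"
    unfolding Inv_def
  proof (intro conjI ballI)
    show "finite R0"
      unfolding R0_def by (intro finite_imageI finite_PiE) (use fin lam_less in auto)
    show "good_state \<sigma>" if "\<sigma> \<in> R0" for \<sigma>
      using that good_state_closed G_init unfolding R0_def by blast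
  qed simp
  have Inv_step: "\<exists>v. ok h v \<and> Inv (h @ [v]) (nxt R h v)" if "Inv h R" for h R
  proof -
    have R: "finite R" "\<And>\<sigma>. \<sigma> \<in> R \<Longrightarrow> good_state \<sigma>"
      and h: "\<And>w i. w \<in> set h \<Longrightarrow> i < k \<Longrightarrow> w i \<in> P i \<rightarrow>\<^sub>E car (S i)"
      using that unfolding Inv_def by (simp_all del: good_state.simps)
    obtain v where v: "ok h v" "\<forall>\<sigma>\<in>R. \<forall>\<sigma>'\<in>moves h v \<sigma>. good_state \<sigma>'"
    proof -
      have "\<exists>v. ok h v \<and> (\<forall>\<sigma>\<in>R. \<forall>\<sigma>'\<in>moves h v \<sigma>. good_state \<sigma>')"
        unfolding ok_def conj_assoc by (rule one_step[OF R]) (simp_all add: h)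
      with that show thesis by blast
    qed
    have "finite (moves h v \<sigma>)" for \<sigma>
      by (rule finite_moves) (rule h)
    then have "finite (nxt R h v)"
      unfolding nxt_def using R(1) by (intro finite_close finite_UnI finite_UN_I)
    moreover have "good_state \<sigma>" if "\<sigma> \<in> R \<union> (\<Union>\<sigma>\<in>R. moves h v \<sigma>)" for \<sigma>
      using that R(2) v(2) by blast
    then have "\<forall>\<sigma>\<in>nxt R h v. good_state \<sigma>"
      unfolding nxt_def close_def using good_state_closings by blast
    ultimately have "Inv (h @ [v]) (nxt R h v)"
      using h v(1) unfolding Inv_def ok_def by auto
    with v(1) show ?thesis by blast
  qed
  \<comment> \<open>Dependent choice runs over pairs of a history and the set of states reached with
    it. The clause for \<open>n = 0\<close> pins down the initial pair.\<close>
  have "\<exists>f. \<forall>n. (Inv (fst (f n)) (snd (f n)) \<and> (n = 0 \<longrightarrow> f n = ([], R0))) \<and>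
    (\<exists>v. ok (fst (f n)) v \<and> f (Suc n) = (fst (f n) @ [v], nxt (snd (f n)) (fst (f n)) v))"
  proof (rule dependent_nat_choice)
    show "\<exists>x. Inv (fst x) (snd x) \<and> ((0::nat) = 0 \<longrightarrow> x = ([], R0))"
      using Inv0 by simp
    fix x :: "(nat \<Rightarrow> 'p \<Rightarrow> 'a) list \<times> ('a, 'p) state set" and n :: nat
    assume "Inv (fst x) (snd x) \<and> (n = 0 \<longrightarrow> x = ([], R0))"
    then obtain v where "ok (fst x) v" "Inv (fst x @ [v]) (nxt (snd x) (fst x) v)"
      using Inv_step by blast
    then show "\<exists>y. (Inv (fst y) (snd y) \<and> (Suc n = 0 \<longrightarrow> y = ([], R0))) \<and>
        (\<exists>v. ok (fst x) v \<and> y = (fst x @ [v], nxt (snd x) (fst x) v))"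
      by (intro exI[of _ "(fst x @ [v], nxt (snd x) (fst x) v)"]) auto
  qed
  then obtain f where f: "\<And>n. Inv (fst (f n)) (snd (f n))" "f 0 = ([], R0)"
      "\<And>n. \<exists>v. ok (fst (f n)) v \<and> f (Suc n) = (fst (f n) @ [v], nxt (snd (f n)) (fst (f n)) v)"
    by blast
  from f(3) obtain X where X: "\<And>n. ok (fst (f n)) (X n)"
      "\<And>n. f (Suc n) = (fst (f n) @ [X n], nxt (snd (f n)) (fst (f n)) (X n))"
    by metis
  have hist: "fst (f n) = map X [0..<n]" for n
    by (induction n) (simp_all add: f(2) X(2))
  show ?thesis
  proof (rule exI[of _ X], rule exI[of _ "\<lambda>n. snd (f n)"], intro conjI)
    show "snd (f 0) = (\<lambda>t. (t, 0, (\<lambda>_. undefined), {}, [])) ` PiE {..<m} (\<lambda>s. P (lam s))"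
      using f(2) by (simp add: R0_def)
    show "\<forall>n. snd (f (Suc n))
        = close (snd (f n) \<union> (\<Union>\<sigma>\<in>snd (f n). moves (map X [0..<n]) (X n) \<sigma>))"
      using X(2) by (simp add: nxt_def hist)
    show "\<forall>n. \<forall>\<sigma>\<in>snd (f n). good_state \<sigma>"
      using f(1) unfolding Inv_def by blast
    show "\<forall>n. \<forall>i<k. X n i \<in> P i \<rightarrow>\<^sub>E car (S i)"
      using X(1) unfolding ok_def by blast
    show "\<forall>n. \<forall>i<k. \<forall>p\<in>P i.
       X n i p \<in> act_sub (\<alpha> i) p \<inter> phi (S i) (\<psi>S i (map (\<lambda>w. w i) (map X [0..<n])))"
      using X(1) unfolding ok_def hist by blast
  qed
qed

section \<open>Tracing a block configuration through the reached states\<close>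

text \<open>The configuration is one path through the sets \<open>R n\<close>, starting from the
  guess \<open>u\<close> of its true least elements. Each block can therefore be closed, and
  goodness of the final state puts the tuple of sums into \<open>G u m\<close>.\<close>

lemma reached_sums:
  assumes R0: "R 0 = (\<lambda>t. (t, 0, (\<lambda>_. undefined), {}, [])) ` PiE {..<m} (\<lambda>s. P (lam s))"
    and RSuc: "\<And>n. R (Suc n) = close (R n \<union> (\<Union>\<sigma>\<in>R n. moves (map X [0..<n]) (X n) \<sigma>))"
    and good: "\<And>n \<sigma>. \<sigma> \<in> R n \<Longrightarrow> good_state \<sigma>"
    and F: "\<And>s. s < m \<Longrightarrow> finite (F s) \<and> F s \<noteq> {}"
    and less: "\<And>s. Suc s < m \<Longrightarrow> block_less (F s) (F (Suc s))"
    and t: "\<And>i n. i < k \<Longrightarrow> t i n \<in> P i"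
    and \<tau>: "\<And>i n. i < k \<Longrightarrow> \<tau> i n \<in> \<psi>F i (map (\<lambda>w. w i) (map X [0..<n]))"
    and u: "u \<in> PiE {..<m} (\<lambda>s. P (lam s))"
    and least: "\<And>s. s < m \<Longrightarrow> chain_least (P (lam s)) (r (lam s))
      ((\<lambda>d. spine (\<alpha> (lam s)) (\<tau> (lam s) d) (t (lam s) d)) ` F s) (u s)"
  shows "\<exists>y\<in>G u m.
    (\<forall>s<m. psum (S (lam s)) (\<lambda>d. \<tau> (lam s) d (X d (lam s) (t (lam s) d))) (F s) = Some (y s))"
proof -
  define q where "q s d = spine (\<alpha> (lam s)) (\<tau> (lam s) d) (t (lam s) d)" for s d
  define z where "z s d = \<tau> (lam s) d (X d (lam s) (t (lam s) d))" for s d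
  \<comment> \<open>The value \<open>undefined\<close> from \<open>s\<close> on matches the initial
    state and the updates made by \<open>closings\<close>.\<close>
  define y where "y s = (\<lambda>j. if j < s then the (psum (S (lam j)) (z j) (F j)) else undefined)" for s
  \<comment> \<open>The stage at which exactly the first \<open>s\<close> blocks are closed: right
    after the last element of the preceding block has been read.\<close>
  define N where "N s = (case s of 0 \<Rightarrow> 0 | Suc j \<Rightarrow> Suc (Max (F j)))" for s
  have mono: "R n \<subseteq> R (Suc n)" for n
    unfolding RSuc[of n] close_def by blast
  have "s \<le> m \<Longrightarrow> (u, s, y s, {}, []) \<in> R (N s) \<and>
      (\<forall>j<s. psum (S (lam j)) (z j) (F j) = Some (y m j))" for s
  proof (induction s)
    case 0
    then show ?case using u by (simp add: R0 N_def y_def)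
  next
    case (Suc s)
    then have s: "s < m" and IH: "(u, s, y s, {}, []) \<in> R (N s)"
      "\<forall>j<s. psum (S (lam j)) (z j) (F j) = Some (y m j)" by auto
    have Fs: "finite (F s)" "F s \<noteq> {}" using F[OF s] by auto
    have Nd: "N s \<le> d" if "d \<in> F s" for d
    proof (cases s)
      case (Suc j)
      then have "Max (F j) < Min (F s)" using less[of j] s by (simp add: block_less_def)
      with that Fs have "Max (F j) < d" by (meson Min_le less_le_trans)
      with Suc show ?thesis by (simp add: N_def)
    qed (simp add: N_def)
    \<comment> \<open>The state on the path after reading the elements of \<open>F s\<close> below
      \<open>n\<close>.\<close>
    let ?\<sigma> = "\<lambda>n. (u, s, y s, q s ` (F s \<inter> {..<n}),
      map (z s) (sorted_list_of_set (F s \<inter> {..<n})))"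
    let ?move = "\<lambda>n. R n \<union> (\<Union>\<sigma>\<in>R n. moves (map X [0..<n]) (X n) \<sigma>)"
    have next_state: "?\<sigma> (Suc n) \<in> ?move n" if "?\<sigma> n \<in> R n" for n
    proof (cases "n \<in> F s")
      case True
      have "?\<sigma> (Suc n) \<in> moves (map X [0..<n]) (X n) (?\<sigma> n)"
      proof -
        let ?f = "\<lambda>(p, \<tau>'). (u, s, y s,
          insert (spine (\<alpha> (lam s)) \<tau>' p) (q s ` (F s \<inter> {..<n})),
          map (z s) (sorted_list_of_set (F s \<inter> {..<n})) @ [\<tau>' (X n (lam s) p)])"
        have "F s \<inter> {..<Suc n} = insert n (F s \<inter> {..<n})" using True by auto
        then have "?\<sigma> (Suc n) = ?f (t (lam s) n, \<tau> (lam s) n)"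
          unfolding sorted_list_of_set_inter_Suc[OF True] by (simp add: q_def z_def)
        moreover have "(t (lam s) n, \<tau> (lam s) n)
            \<in> P (lam s) \<times> \<psi>F (lam s) (map (\<lambda>w. w (lam s)) (map X [0..<n]))"
          using t \<tau> lam_less[OF s] by blast
        ultimately have "?\<sigma> (Suc n)
            \<in> ?f ` (P (lam s) \<times> \<psi>F (lam s) (map (\<lambda>w. w (lam s)) (map X [0..<n])))"
          by (rule image_eqI)
        then show ?thesis using s by (simp only: moves.simps if_True)
      qed
      with that show ?thesis by blast
    next
      case False
      then have "F s \<inter> {..<Suc n} = F s \<inter> {..<n}" by (auto simp: less_Suc_eq)
      with that show ?thesis by simp
    qed
    have reach: "N s \<le> n \<Longrightarrow> ?\<sigma> n \<in> R n" for n
    proof (induction n rule: dec_induct)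
      case base
      have "F s \<inter> {..<N s} = {}" using Nd by force
      with IH(1) show ?case by simp
    next
      case (step n)
      from next_state[OF step.IH] show ?case unfolding RSuc[of n] close_def by blast
    qed
    let ?M = "Max (F s)"
    have FM: "F s \<inter> {..<Suc ?M} = F s" using Fs by (auto simp: less_Suc_eq_le)
    have "?M \<in> F s" using Fs by simp
    \<comment> \<open>Membership in \<open>?move ?M\<close> is recorded because
      \<open>closings\<close> is applied to that set within the same stage, so the closed state
      already lies in \<open>R (Suc ?M)\<close>.\<close>
    then have mem: "?\<sigma> (Suc ?M) \<in> ?move ?M"
      by (intro next_state reach Nd)
    then have "?\<sigma> (Suc ?M) \<in> R (Suc ?M)" unfolding RSuc[of ?M] close_def by blast
    then have g: "good_state (u, s, y s, q s ` F s, map (z s) (sorted_list_of_set (F s)))"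
      using good unfolding FM by blast
    have ne: "map (z s) (sorted_list_of_set (F s)) \<noteq> []" using Fs by simp
    have cl: "chain_least (P (lam s)) (r (lam s)) (q s ` F s) (u s)"
      using least[OF s] unfolding q_def .
    obtain a where a: "psum (S (lam s)) (z s) (F s) = Some a"
      using good_state_psum[OF g s ne cl] by (auto simp: psum_def)
    have yS: "y (Suc s) = (y s)(s := a)"
      using a by (auto simp: y_def fun_eq_iff less_Suc_eq)
    have "(u, Suc s, y (Suc s), {}, []) \<in> closings (?\<sigma> (Suc ?M))"
      unfolding FM using s ne cl a yS by (simp add: psum_def)
    with mem have "(u, Suc s, y (Suc s), {}, []) \<in> R (N (Suc s))"
      unfolding N_def nat.case RSuc[of ?M] close_def by blast
    moreover have "psum (S (lam s)) (z s) (F s) = Some (y m s)"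
      using a s by (simp add: y_def)
    ultimately show ?case using IH(2) less_Suc_eq by auto
  qed
  from this[OF order_refl] have "(u, m, y m, {}, []) \<in> R (N m)"
    and sums: "\<forall>j<m. psum (S (lam j)) (z j) (F j) = Some (y m j)" by auto
  from good[OF this(1)] have "y m \<in> G u m" by simp
  with sums show ?thesis
    unfolding z_def by (rule bexI)
qed

end

section \<open>Colorings of tuples of block sums\<close>

theorem theorem3p6:
  fixes k m :: nat
    and lam :: "nat \<Rightarrow> nat"
    and S :: "nat \<Rightarrow> 'a psg"
    and P :: "nat \<Rightarrow> 'p set"
    and r :: "nat \<Rightarrow> 'p rel"
    and \<alpha> :: "nat \<Rightarrow> ('a, 'p) psg_action"
    and \<xi> :: "nat \<Rightarrow> 'p \<Rightarrow> 'a set set"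
    and c :: "(nat \<Rightarrow> 'a) \<Rightarrow> 'c"
    and \<psi>F :: "nat \<Rightarrow> ('p \<Rightarrow> 'a) list \<Rightarrow> ('a \<Rightarrow> 'a) set"
    and \<psi>S :: "nat \<Rightarrow> ('p \<Rightarrow> 'a) list \<Rightarrow> 'a set"
  assumes "lam \<in> {..<m} \<rightarrow> {..<k}"
    and "\<And>i. i < k \<Longrightarrow> adequate (S i)"
    and "\<And>i. i < k \<Longrightarrow> finite (P i)"
    and "\<And>i. i < k \<Longrightarrow> partial_order_on (P i) (r i)"
    and "\<And>i. i < k \<Longrightarrow> is_action (S i) (P i) (r i) (\<alpha> i)"
    and "\<And>i. i < k \<Longrightarrow> \<xi> i \<in> gamma_action (S i) (P i) (\<alpha> i)"
    and "\<And>i. i < k \<Longrightarrow> order_preserving_idempotent (S i) (P i) (r i) (\<xi> i)"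
    and "finite (c ` PiE {..<m} (\<lambda>s. car (S (lam s))))"
    and "\<And>i. i < k \<Longrightarrow> admissible_psi (S i) (P i) (\<alpha> i) (\<psi>F i) (\<psi>S i)"
  shows "\<exists>x :: nat \<Rightarrow> nat \<Rightarrow> 'p \<Rightarrow> 'a.
    (\<forall>i<k. \<forall>n. x i n \<in> P i \<rightarrow>\<^sub>E car (S i)) \<and>
    (\<forall>n. \<forall>i<k. \<forall>t\<in>P i.
       x i n t \<in> act_sub (\<alpha> i) t \<inter> phi (S i) (\<psi>S i (map (x i) [0..<n]))) \<and>
    (\<forall>(F :: nat \<Rightarrow> nat set) (t :: nat \<Rightarrow> nat \<Rightarrow> 'p) (\<tau> :: nat \<Rightarrow> nat \<Rightarrow> 'a \<Rightarrow> 'a)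
      (t' :: nat \<Rightarrow> 'p).
       (\<forall>s<m. finite (F s) \<and> F s \<noteq> {}) \<and>
       (\<forall>s. Suc s < m \<longrightarrow> block_less (F s) (F (Suc s))) \<and>
       (\<forall>i<k. \<forall>n. t i n \<in> P i) \<and>
       (\<forall>i<k. \<forall>n. \<tau> i n \<in> act_maps (\<alpha> i) \<and> \<tau> i n \<in> \<psi>F i (map (x i) [0..<n])) \<and>
       (\<forall>s<m. (\<lambda>d. spine (\<alpha> (lam s)) (\<tau> (lam s) d) (t (lam s) d)) ` F s \<in> Chains (r (lam s)) \<and>
          least_of (r (lam s))
            ((\<lambda>d. spine (\<alpha> (lam s)) (\<tau> (lam s) d) (t (lam s) d)) ` F s) (t' s)) \<longrightarrow>
       (\<exists>y \<in> PiE {..<m} (\<lambda>s. car (S (lam s))).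
          (\<forall>s<m. psum (S (lam s)) (\<lambda>d. \<tau> (lam s) d (x (lam s) d (t (lam s) d))) (F s)
                   = Some (y s)) \<and>
          c y = color_ext (PiE {..<m} (\<lambda>s. car (S (lam s)))) c
                  (utensor_iter (\<lambda>s. car (S (lam s))) (\<lambda>s. \<xi> (lam s) (t' s)) m)))"
proof -
  let ?D = "\<lambda>s. car (S (lam s))" and ?T = "PiE {..<m} (\<lambda>s. P (lam s))"
  let ?W = "\<lambda>t s. \<xi> (lam s) (t s)"
  let ?col = "\<lambda>t. color_ext (PiE {..<m} ?D) c (utensor_iter ?D (?W t) m)"
  have lam_k: "lam s < k" if "s < m" for s using assms(1) that by auto
  let ?sections = "\<lambda>t G. G m = {y \<in> PiE {..<m} ?D. c y = ?col t} \<and> (\<lambda>_. undefined) \<in> G 0 \<and>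
      (\<forall>s<m. \<forall>y\<in>G s. {a \<in> ?D s. y(s := a) \<in> G (Suc s)} \<in> ?W t s)"
  \<comment> \<open>By \<open>color_ext_iff\<close> the tuples of color \<open>?col t\<close> form a
    large set for the tensor product belonging to \<open>t\<close>, and the tree is obtained from
    that set.\<close>
  have "\<exists>G. ?sections t G" if t: "t \<in> ?T" for t
  proof (rule utensor_iter_sections)
    have "ultrafilter_on (?D s) (?W t s)" if "s < m" for s
    proof -
      have "t s \<in> P (lam s)" using t that by auto
      then show ?thesis
        using assms(6)[OF lam_k[OF that]] by (auto simp: gamma_action_def gamma_sub_def gamma_def)
    qed
    then have "ultrafilter_on (PiE {..<m} ?D) (utensor_iter ?D (?W t) m)"
      by (rule ultrafilter_on_utensor_iter)
    from color_ext_iff[OF this assms(8), of "?col t"]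
    show "{y \<in> PiE {..<m} ?D. c y = ?col t} \<in> utensor_iter ?D (?W t) m" by simp
  qed
  then have "\<forall>t\<in>?T. \<exists>G. ?sections t G" by (intro ballI)
  from bchoice[OF this] obtain G where "\<forall>t\<in>?T. ?sections t (G t)" by (elim exE)
  note G = bspec[OF this]
  interpret action_family k m lam S P r \<alpha> \<xi> \<psi>F \<psi>S G
  proof
    show "(\<lambda>_. undefined) \<in> G t 0" if "t \<in> ?T" for t
      using conjunct1[OF conjunct2[OF G[OF that]]] .
    show "{a \<in> ?D s. y(s := a) \<in> G t (Suc s)} \<in> ?W t s"
      if "t \<in> ?T" "s < m" "y \<in> G t s" for t s y
      using conjunct2[OF conjunct2[OF G[OF that(1)]]] that(2,3) by simp
  qed (fact assms)+
  obtain X R where R: "R 0 = (\<lambda>t. (t, 0, (\<lambda>_. undefined), {}, [])) ` ?T"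
      "\<And>n. R (Suc n) = close (R n \<union> (\<Union>\<sigma>\<in>R n. moves (map X [0..<n]) (X n) \<sigma>))"
      "\<And>n \<sigma>. \<sigma> \<in> R n \<Longrightarrow> good_state \<sigma>"
    and X: "\<forall>n. \<forall>i<k. X n i \<in> P i \<rightarrow>\<^sub>E car (S i)"
      "\<forall>n. \<forall>i<k. \<forall>p\<in>P i.
         X n i p \<in> act_sub (\<alpha> i) p \<inter> phi (S i) (\<psi>S i (map (\<lambda>w. w i) (map X [0..<n])))"
  proof -
    from good_sequence obtain X R where XR:
      "R 0 = (\<lambda>t. (t, 0, (\<lambda>_. undefined), {}, [])) ` ?T"
      "\<forall>n. R (Suc n) = close (R n \<union> (\<Union>\<sigma>\<in>R n. moves (map X [0..<n]) (X n) \<sigma>))"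
      "\<forall>n. \<forall>\<sigma>\<in>R n. good_state \<sigma>"
      "\<forall>n. \<forall>i<k. X n i \<in> P i \<rightarrow>\<^sub>E car (S i)"
      "\<forall>n. \<forall>i<k. \<forall>p\<in>P i.
         X n i p \<in> act_sub (\<alpha> i) p \<inter> phi (S i) (\<psi>S i (map (\<lambda>w. w i) (map X [0..<n])))"
      by (elim exE conjE)
    show thesis
      by (rule that[OF XR(1) spec[OF XR(2)] bspec[OF spec[OF XR(3)]] XR(4,5)])
  qed
  have hist: "map (\<lambda>w. w i) (map X [0..<n]) = map (\<lambda>n. X n i) [0..<n]" for i n
    by simp
  show ?thesis
  \<comment> \<open>The recursion chooses all components of one stage together, so \<open>X\<close>
    takes the stage first; the witness swaps the two arguments.\<close>
  proof (rule exI[of _ "\<lambda>i n. X n i"], intro conjI allI impI)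
    show "X n i \<in> P i \<rightarrow>\<^sub>E car (S i)" if "i < k" for i n
      using X(1) that by blast
    show "\<forall>t\<in>P i. X n i t \<in> act_sub (\<alpha> i) t \<inter> phi (S i) (\<psi>S i (map (\<lambda>n. X n i) [0..<n]))"
      if "i < k" for i n
      using X(2) that unfolding hist by blast
    fix F :: "nat \<Rightarrow> nat set" and t :: "nat \<Rightarrow> nat \<Rightarrow> 'p" and \<tau> :: "nat \<Rightarrow> nat \<Rightarrow> 'a \<Rightarrow> 'a"
      and t' :: "nat \<Rightarrow> 'p"
    let ?q = "\<lambda>s d. spine (\<alpha> (lam s)) (\<tau> (lam s) d) (t (lam s) d)"
    assume "(\<forall>s<m. finite (F s) \<and> F s \<noteq> {}) \<and>
       (\<forall>s. Suc s < m \<longrightarrow> block_less (F s) (F (Suc s))) \<and>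
       (\<forall>i<k. \<forall>n. t i n \<in> P i) \<and>
       (\<forall>i<k. \<forall>n. \<tau> i n \<in> act_maps (\<alpha> i) \<and> \<tau> i n \<in> \<psi>F i (map (\<lambda>n. X n i) [0..<n])) \<and>
       (\<forall>s<m. ?q s ` F s \<in> Chains (r (lam s)) \<and> least_of (r (lam s)) (?q s ` F s) (t' s))"
    then have F: "\<forall>s<m. finite (F s) \<and> F s \<noteq> {}"
      and less: "\<forall>s. Suc s < m \<longrightarrow> block_less (F s) (F (Suc s))"
      and t: "\<forall>i<k. \<forall>n. t i n \<in> P i"
      and \<tau>: "\<forall>i<k. \<forall>n. \<tau> i n \<in> act_maps (\<alpha> i) \<and> \<tau> i n \<in> \<psi>F i (map (\<lambda>n. X n i) [0..<n])"
      and chain: "\<forall>s<m. ?q s ` F s \<in> Chains (r (lam s)) \<and> least_of (r (lam s)) (?q s ` F s) (t' s)"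
      by - (elim conjE, assumption)+
    \<comment> \<open>\<open>t'\<close> is arbitrary outside \<open>{..<m}\<close>; its restriction
      is one of the guesses in \<open>?T\<close>.\<close>
    define u where "u = restrict t' {..<m}"
    have q: "?q s d \<in> P (lam s)" if "s < m" for s d
    proof -
      have "t (lam s) d \<in> P (lam s)" "\<tau> (lam s) d \<in> act_maps (\<alpha> (lam s))"
        using t \<tau> lam_less[OF that] by simp_all
      then show ?thesis
        using act[OF lam_less[OF that]] unfolding is_action_def by blast
    qed
    have least: "chain_least (P (lam s)) (r (lam s)) (?q s ` F s) (u s)" if "s < m" for s
      unfolding chain_least_def u_def using chain q[OF that] that by (simp add: image_subset_iff)
    have u: "u \<in> ?T"
    proof (rule PiE_I)
      show "u s \<in> P (lam s)" if "s \<in> {..<m}" for s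
        using least[of s] that unfolding chain_least_def least_of_def by blast
    qed (simp add: u_def)
    have sums: "\<exists>y\<in>G u m.
        (\<forall>s<m. psum (S (lam s)) (\<lambda>d. \<tau> (lam s) d (X d (lam s) (t (lam s) d))) (F s) = Some (y s))"
    proof (rule reached_sums[OF R, where F = F and t = t and \<tau> = \<tau>])
      show "\<tau> i n \<in> \<psi>F i (map (\<lambda>w. w i) (map X [0..<n]))" if "i < k" for i n
        unfolding hist using \<tau> that by blast
    qed (use F less t u least in simp_all)
    \<comment> \<open>Only the ultrafilters with index below \<open>m\<close> enter the product, so
      passing from \<open>t'\<close> to \<open>u\<close> leaves the target color unchanged.\<close>
    have "utensor_iter ?D (?W u) m = utensor_iter ?D (?W t') m"
      by (rule utensor_iter_cong) (simp add: u_def)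
    moreover have "G u m = {y \<in> PiE {..<m} ?D. c y = ?col u}"
      using conjunct1[OF G[OF u]] .
    ultimately show "\<exists>y \<in> PiE {..<m} ?D.
          (\<forall>s<m. psum (S (lam s)) (\<lambda>d. \<tau> (lam s) d (X d (lam s) (t (lam s) d))) (F s)
                   = Some (y s)) \<and>
          c y = ?col t'"
      using sums by (elim bexE conjE) (rule bexI, rule conjI, assumption, simp_all)
  qed
qed

end
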